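(* Let $j=\exp(2\pi \mathrm{i}/3)$ and let $\delta_1,\delta_2$ be the Demazure operators on $\mathbf{C}[x,y]$ attached to the two generating reflections $s_1,s_2$ of $G_4$. Then $\delta_1\delta_2\delta_1 \notin \mathbf{Q}(j)^{\times}\,\delta_2\delta_1\delta_2$. Hence the Demazure operators associated to the braid diagram of $G_4$ (two generators $s_1,s_2$ with braid relation $s_1s_2s_1=s_2s_1s_2$) do not satisfy the braid relation up to a scalar.
   Context: The reflection group $G_4\subset \mathrm{GL}_2(\mathbf{C})$ is generated by $s_1=\begin{pmatrix}1&0\\0&j\end{pmatrix}$ and $s_2=\frac13\begin{pmatrix} j-j^2 & 2j+j^2\\ 4j+2j^2 & -j-2j^2\end{pmatrix}$. Let $V=\mathbf{C}^2$ with canonical basis $x=e_1$, $y=e_2$, so that the symmetric algebra is $S(V)=\mathbf{C}[x,y]$, on which $s_1,s_2$ act by algebra automorphisms extending their action on $V$ (matrices acting on column vectors; e.g. $s_2$ maps $x$ to $((j-j^2)x+(4j+2j^2)y)/3$). A root of $s_1$ is $y$ and a root of $s_2$ is $x+y$; the Demazure operators $\delta_1,\delta_2:\mathbf{C}[x,y]\to\mathbf{C}[x,y]$ are the linear maps defined (up to a nonzero scalar normalization) by $s_1.p-p=y\,\delta_1(p)$ and $s_2.p-p=(x+y)\,\delta_2(p)$ for all $p\in \mathbf{C}[x,y]$. *)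

theory Defs
  imports "HOL-Analysis.Analysis" "HOL-Computational_Algebra.Polynomial"
begin

text \<open>
  The polynomial ring \<open>\<complex>[x,y]\<close> is rendered as \<open>\<complex>[x][y]\<close>, i.e. the type \<open>complex poly poly\<close>;
  the outer variable is \<open>y\<close>. It is the symmetric algebra of \<open>V = \<complex>\<^sup>2\<close>, with
  \<open>x = e\<^sub>1\<close> and \<open>y = e\<^sub>2\<close>.
\<close>

type_synonym cpoly2 = "complex poly poly"

definition const2 :: "complex \<Rightarrow> cpoly2" where
  "const2 c = [:[:c:]:]"

definition var_x :: cpoly2 where
  "var_x = [:[:0, 1:]:]"

definition var_y :: cpoly2 where
  "var_y = [:0, 1:]"

definition scale2 :: "complex \<Rightarrow> cpoly2 \<Rightarrow> cpoly2" where
  "scale2 c p = smult [:c:] p"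

definition lin_form :: "complex ^ 2 \<Rightarrow> cpoly2" where
  "lin_form v = scale2 (v $ 1) var_x + scale2 (v $ 2) var_y"

text \<open>The value \<open>p(F, G)\<close>, i.e. \<open>F\<close> is substituted for \<open>x\<close> and \<open>G\<close> for \<open>y\<close>.\<close>

definition subst_x :: "cpoly2 \<Rightarrow> complex poly \<Rightarrow> cpoly2" where
  "subst_x F q = poly (map_poly const2 q) F"

definition subst2 :: "cpoly2 \<Rightarrow> cpoly2 \<Rightarrow> cpoly2 \<Rightarrow> cpoly2" where
  "subst2 F G p = poly (map_poly (subst_x F) p) G"

text \<open>
  The algebra endomorphism of \<open>S(V)\<close> extending the endomorphism \<open>v \<mapsto> A v\<close> of \<open>V\<close>:
  it maps \<open>x\<close> and \<open>y\<close> to the first and second column of \<open>A\<close>.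
\<close>

definition sym_act :: "complex ^ 2 ^ 2 \<Rightarrow> cpoly2 \<Rightarrow> cpoly2" where
  "sym_act A = subst2 (lin_form (A *v axis 1 1)) (lin_form (A *v axis 2 1))"

text \<open>
  The Demazure operator of \<open>A\<close> with respect to the root \<open>\<alpha>\<close>. The description is only
  meaningful if \<open>\<alpha>\<close> is nonzero and divides \<open>A.p - p\<close> for all \<open>p\<close>; for the two
  reflections below, see \<open>demazure_refl1\<close> and \<open>demazure_refl2\<close>.
  Multiplying \<open>\<alpha>\<close> by a nonzero scalar accounts for the choice of normalization.
\<close>

definition demazure :: "complex ^ 2 ^ 2 \<Rightarrow> cpoly2 \<Rightarrow> cpoly2 \<Rightarrow> cpoly2" where
  "demazure A \<alpha> p = (THE q. sym_act A p - p = \<alpha> * q)"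

definition root_j :: complex where
  "root_j = exp (2 * of_real pi * \<i> / 3)"

text \<open>The generating reflections of \<open>G\<^sub>4\<close>; the inner vectors are the rows.\<close>

definition refl1 :: "complex ^ 2 ^ 2" where
  "refl1 = vector [vector [1, 0], vector [0, root_j]]"

definition refl2 :: "complex ^ 2 ^ 2" where
  "refl2 = vector
     [vector [(root_j - root_j\<^sup>2) / 3,         (2 * root_j + root_j\<^sup>2) / 3],
      vector [(4 * root_j + 2 * root_j\<^sup>2) / 3, (- root_j - 2 * root_j\<^sup>2) / 3]]"

definition is_subfield :: "complex set \<Rightarrow> bool" where
  "is_subfield K \<longleftrightarrow> 0 \<in> K \<and> 1 \<in> K \<and>
     (\<forall>u\<in>K. \<forall>v\<in>K. u - v \<in> K \<and> u * v \<in> K) \<and> (\<forall>u\<in>K. inverse u \<in> K)"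

text \<open>A subfield of \<open>\<complex>\<close> contains \<open>\<rat>\<close>, so this is \<open>\<rat>(j)\<close>.\<close>

definition rat_adjoin_j :: "complex set" where
  "rat_adjoin_j = is_subfield hull {root_j}"


lemma const2_0 [simp]: "const2 0 = 0"
  by (simp add: const2_def)

lemma scale2_eq: "scale2 c p = const2 c * p"
  by (simp add: scale2_def const2_def)

lemma subst_x_0 [simp]: "subst_x F 0 = 0"
  by (simp add: subst_x_def)

lemma subst_x_pCons: "subst_x F (pCons c q) = const2 c + F * subst_x F q"
  by (simp add: subst_x_def map_poly_pCons)

lemma subst2_0 [simp]: "subst2 F G 0 = 0"
  by (simp add: subst2_def)

lemma subst2_pCons: "subst2 F G (pCons q p) = subst_x F q + G * subst2 F G p"
  by (simp add: subst2_def map_poly_pCons)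

lemma subst_x_add: "subst_x F (p + q) = subst_x F p + subst_x F q"
proof (induction p q rule: poly_induct2)
  case (pCons a p b q)
  then show ?case
    by (simp add: subst_x_pCons algebra_simps const2_def)
qed simp

lemma subst_x_mult: "subst_x F (p * q) = subst_x F p * subst_x F q"
proof (induction p)
  case (pCons a p)
  have "subst_x F (smult a q) = const2 a * subst_x F q"
    by (induction q) (simp_all add: subst_x_pCons algebra_simps const2_def)
  with pCons show ?case
    by (simp add: subst_x_pCons subst_x_add algebra_simps)
qed simp

lemma subst2_add: "subst2 F G (p + q) = subst2 F G p + subst2 F G q"
proof (induction p q rule: poly_induct2)
  case (pCons a p b q)
  then show ?case
    by (simp add: subst2_pCons subst_x_add algebra_simps)
qed simp

lemma subst2_mult: "subst2 F G (p * q) = subst2 F G p * subst2 F G q"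
proof (induction p)
  case (pCons a p)
  have "subst2 F G (smult a q) = subst_x F a * subst2 F G q"
    by (induction q) (simp_all add: subst2_pCons subst_x_mult algebra_simps)
  with pCons show ?case
    by (simp add: subst2_pCons subst2_add algebra_simps)
qed simp

lemma subst2_const2 [simp]: "subst2 F G (const2 c) = const2 c"
  by (subst const2_def) (simp add: subst2_pCons subst_x_pCons)

lemma subst_x_1 [simp]: "subst_x F 1 = 1"
  unfolding one_pCons subst_x_pCons by (simp add: const2_def flip: one_pCons)

lemma subst2_var_x [simp]: "subst2 F G var_x = F"
  by (simp add: var_x_def subst2_pCons subst_x_pCons flip: one_pCons)

lemma subst2_var_y [simp]: "subst2 F G var_y = G"
  by (simp add: var_y_def subst2_pCons)

lemma sym_act_add: "sym_act A (p + q) = sym_act A p + sym_act A q"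
  by (simp add: sym_act_def subst2_add)

lemma sym_act_mult: "sym_act A (p * q) = sym_act A p * sym_act A q"
  by (simp add: sym_act_def subst2_mult)

lemma sym_act_const2: "sym_act A (const2 c) = const2 c"
  by (simp add: sym_act_def)

lemma sym_act_var_x: "sym_act A var_x = scale2 (A $ 1 $ 1) var_x + scale2 (A $ 2 $ 1) var_y"
  by (simp add: sym_act_def lin_form_def matrix_vector_mult_def axis_def sum_2)

lemma sym_act_var_y: "sym_act A var_y = scale2 (A $ 1 $ 2) var_x + scale2 (A $ 2 $ 2) var_y"
  by (simp add: sym_act_def lin_form_def matrix_vector_mult_def axis_def sum_2)

lemma dvd_sym_act_diff:
  assumes "\<alpha> dvd sym_act A var_x - var_x" and "\<alpha> dvd sym_act A var_y - var_y"
  shows "\<alpha> dvd sym_act A p - p"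
proof -
  have dvd_mult_diff: "\<alpha> dvd u * v - u' * v'" if "\<alpha> dvd u - u'" "\<alpha> dvd v - v'" for u v u' v' :: cpoly2
  proof -
    have "u * v - u' * v' = (u - u') * v + u' * (v - v')"
      by (simp add: algebra_simps)
    with that show ?thesis by simp
  qed
  have dvd_add_diff: "\<alpha> dvd (u + v) - (u' + v')" if "\<alpha> dvd u - u'" "\<alpha> dvd v - v'" for u v u' v' :: cpoly2
    using dvd_add[OF that] by (simp add: algebra_simps)
  have inner: "\<alpha> dvd sym_act A [:q:] - [:q:]" for q
  proof (induction q)
    case 0
    then show ?case by (simp add: sym_act_def)
  next
    case (pCons c q)
    have "[:pCons c q:] = const2 c + var_x * [:q:]"
      by (simp add: const2_def var_x_def)
    moreover have "\<alpha> dvd sym_act A (const2 c + var_x * [:q:]) - (const2 c + var_x * [:q:])"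
      unfolding sym_act_add sym_act_mult
      by (intro dvd_add_diff dvd_mult_diff assms pCons) (simp add: sym_act_const2)
    ultimately show ?case by simp
  qed
  show ?thesis
  proof (induction p)
    case 0
    then show ?case by (simp add: sym_act_def)
  next
    case (pCons q p)
    have "pCons q p = [:q:] + var_y * p"
      by (simp add: var_y_def)
    moreover have "\<alpha> dvd sym_act A ([:q:] + var_y * p) - ([:q:] + var_y * p)"
      unfolding sym_act_add sym_act_mult
      by (intro dvd_add_diff dvd_mult_diff assms pCons inner)
    ultimately show ?case by simp
  qed
qed

lemma demazure_unique:
  assumes "\<alpha> \<noteq> 0" and "sym_act A p - p = \<alpha> * q"
  shows "demazure A \<alpha> p = q"
  unfolding demazure_def by (rule the_equality) (use assms in auto)

lemma demazure_eq:
  assumes "\<alpha> \<noteq> 0" and "\<alpha> dvd sym_act A p - p"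
  shows "sym_act A p - p = \<alpha> * demazure A \<alpha> p"
  using assms demazure_unique by (metis dvdE)

lemma scale2_dvd:
  assumes "a \<noteq> 0" and "\<alpha> dvd p"
  shows "scale2 a \<alpha> dvd p"
proof -
  obtain q where "p = \<alpha> * q" using assms(2) by (elim dvdE)
  then have "p = scale2 a \<alpha> * scale2 (1 / a) q"
    using assms(1) by (simp add: scale2_def flip: one_pCons)
  then show ?thesis by simp
qed

lemma root_j_minimal: "root_j\<^sup>2 = - root_j - 1"
  by (simp add: root_j_def exp_eq_polar complex_eq_iff power2_eq_square cos_120 sin_120)

lemma demazure_refl1:
  assumes "a \<noteq> 0"
  shows "sym_act refl1 p - p = scale2 a var_y * demazure refl1 (scale2 a var_y) p"
proof (rule demazure_eq)
  show "scale2 a var_y \<noteq> 0"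
    using assms by (simp add: scale2_def var_y_def)
  show "scale2 a var_y dvd sym_act refl1 p - p"
  proof (rule scale2_dvd[OF assms dvd_sym_act_diff])
    show "var_y dvd sym_act refl1 var_x - var_x"
      by (simp add: sym_act_var_x refl1_def scale2_def flip: one_pCons)
    show "var_y dvd sym_act refl1 var_y - var_y"
      by (simp add: sym_act_var_y refl1_def scale2_eq)
  qed
qed

lemma demazure_refl2:
  assumes "a \<noteq> 0"
  shows "sym_act refl2 p - p
    = scale2 a (var_x + var_y) * demazure refl2 (scale2 a (var_x + var_y)) p"
proof (rule demazure_eq)
  show "scale2 a (var_x + var_y) \<noteq> 0"
    using assms by (simp add: scale2_def var_x_def var_y_def)
  show "scale2 a (var_x + var_y) dvd sym_act refl2 p - p"
  proof (rule scale2_dvd[OF assms dvd_sym_act_diff])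
    have "sym_act refl2 var_x - var_x = (var_x + var_y) * const2 (2 * (root_j - 1) / 3)"
      unfolding sym_act_var_x refl2_def
      by (simp add: scale2_def root_j_minimal const2_def var_x_def var_y_def field_simps)
    then show "var_x + var_y dvd sym_act refl2 var_x - var_x" by simp
    have "sym_act refl2 var_y - var_y = (var_x + var_y) * const2 ((root_j - 1) / 3)"
      unfolding sym_act_var_y refl2_def
      by (simp add: scale2_def root_j_minimal const2_def var_x_def var_y_def one_pCons field_simps)
    then show "var_x + var_y dvd sym_act refl2 var_y - var_y" by simp
  qed
qed

end

theory Submission
  imports Defs
begin

text \<open>
  The polynomial \<open>x\<^sup>3\<close> separates the two composites. It is fixed by \<open>s\<^sub>1\<close>, hence killed by
  \<open>\<delta>\<^sub>1\<close> and by \<open>\<delta>\<^sub>1\<delta>\<^sub>2\<delta>\<^sub>1\<close>. On the other hand \<open>\<delta>\<^sub>2\<delta>\<^sub>1\<delta>\<^sub>2(x\<^sup>3)\<close> is a nonzero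
  constant, because each operator lowers the degree by one and the three successive quotients
  can be computed explicitly. So \<open>\<delta>\<^sub>1\<delta>\<^sub>2\<delta>\<^sub>1 = c \<delta>\<^sub>2\<delta>\<^sub>1\<delta>\<^sub>2\<close> is impossible for every nonzero
  complex number \<open>c\<close>, in particular for \<open>c\<close> in \<open>\<rat>(j)\<^sup>\<times>\<close>.

  The computation is short in terms of \<open>k = (j - 1) / 3\<close>. With the root \<open>\<alpha> = x + y\<close>, the
  second reflection is \<open>x \<mapsto> x + 2k\<alpha>\<close>, \<open>y \<mapsto> y + k\<alpha>\<close>, the first is \<open>x \<mapsto> x\<close>,
  \<open>y \<mapsto> y + 3ky\<close>, and the only arithmetic fact about \<open>j\<close> that enters is
  \<open>3k\<^sup>2 + 3k + 1 = 0\<close>. Replacing the roots by multiples \<open>ay\<close> and \<open>b\<alpha>\<close> only divides the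
  constant by \<open>ab\<^sup>2\<close>. The entries of \<open>s\<^sub>1s\<^sub>2s\<^sub>1 - s\<^sub>2s\<^sub>1s\<^sub>2\<close> are multiples of
  \<open>3k\<^sup>2 + 3k + 1\<close>, which gives the braid relation of the reflections themselves.
\<close>

lemma const2_add: "const2 (c + d) = const2 c + const2 d"
  by (simp add: const2_def)

lemma const2_mult: "const2 (c * d) = const2 c * const2 d"
  by (simp add: const2_def)

lemma const2_1: "const2 1 = 1"
  by (simp add: const2_def one_pCons)

lemma const2_numeral: "const2 (numeral n) = numeral n"
  by (simp add: const2_def numeral_poly)

lemma sym_act_0: "sym_act A 0 = 0"
  by (simp add: sym_act_def)

lemma sym_act_power: "sym_act A (p ^ n) = sym_act A p ^ n"
  by (induction n) (simp_all add: sym_act_mult sym_act_const2 flip: const2_1)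

lemma sym_act_numeral: "sym_act A (numeral n) = numeral n"
  using sym_act_const2[of A "numeral n"] by (simp add: const2_numeral)

lemma sym_act_minus: "sym_act A (- p) = - sym_act A p"
  using sym_act_add[of A p "- p"] by (simp add: sym_act_def eq_neg_iff_add_eq_0 add.commute)

lemma sym_act_diff: "sym_act A (p - q) = sym_act A p - sym_act A q"
  using sym_act_add[of A p "- q"] by (simp add: sym_act_minus)

lemmas sym_act_hom = sym_act_add sym_act_diff sym_act_mult sym_act_power sym_act_numeral
  sym_act_const2

text \<open>
  A quotient by the root \<open>\<alpha>\<close> found for \<open>p\<close> determines the Demazure operator for every
  multiple of \<open>\<alpha>\<close> on every multiple of \<open>p\<close>, so that scalars can be carried along outside
  the polynomial identities.
\<close>

lemma demazure_scale2:
  assumes "\<alpha> \<noteq> 0" and "a \<noteq> 0" and "sym_act A p - p = \<alpha> * scale2 c q"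
  shows "demazure A (scale2 a \<alpha>) (scale2 d p) = scale2 (d * c / a) q"
proof (rule demazure_unique)
  show "scale2 a \<alpha> \<noteq> 0"
    using assms by (simp add: scale2_def)
  have "sym_act A (scale2 d p) - scale2 d p = const2 d * (sym_act A p - p)"
    by (simp add: scale2_eq sym_act_hom algebra_simps)
  also have "\<dots> = const2 (d * c) * (\<alpha> * q)"
    using assms(3) by (simp add: scale2_eq const2_mult)
  also have "d * c = a * (d * c / a)"
    using assms(2) by simp
  also have "const2 (a * (d * c / a)) * (\<alpha> * q) = scale2 a \<alpha> * scale2 (d * c / a) q"
    unfolding scale2_eq const2_mult by (simp only: mult_ac)
  finally show "sym_act A (scale2 d p) - scale2 d p = scale2 a \<alpha> * scale2 (d * c / a) q" .
qed

definition k :: complex where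
  "k = (root_j - 1) / 3"

lemma root_j_eq_k: "root_j = 1 + 3 * k"
  by (simp add: k_def field_simps)

lemma k_minimal: "3 * k\<^sup>2 + 3 * k + 1 = 0"
  using root_j_minimal unfolding root_j_eq_k by algebra

lemma k_nonzero: "k \<noteq> 0"
  using k_minimal by auto

lemma const2_k_minimal: "3 * (const2 k)\<^sup>2 + 3 * const2 k + 1 = 0"
  using arg_cong[OF k_minimal, of const2]
  by (simp add: const2_add const2_mult const2_1 const2_numeral power2_eq_square)

lemma refl1_var_x: "sym_act refl1 var_x = var_x"
  by (simp add: sym_act_var_x refl1_def scale2_def flip: one_pCons)

lemma refl1_var_y: "sym_act refl1 var_y = var_y + 3 * const2 k * var_y"
  by (simp add: sym_act_var_y refl1_def scale2_eq root_j_eq_k const2_add const2_mult const2_1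
      const2_numeral algebra_simps)

lemma refl2_eq_k:
  "refl2 = vector [vector [1 + 2 * k, k], vector [2 * k, 1 + k]]"
proof -
  have "(root_j - root_j\<^sup>2) / 3 = 1 + 2 * k" "(2 * root_j + root_j\<^sup>2) / 3 = k"
    "(4 * root_j + 2 * root_j\<^sup>2) / 3 = 2 * k" "(- root_j - 2 * root_j\<^sup>2) / 3 = 1 + k"
    by (simp_all add: root_j_minimal k_def field_simps)
  then show ?thesis
    by (simp only: refl2_def)
qed

lemma refl2_var_x: "sym_act refl2 var_x = var_x + 2 * const2 k * (var_x + var_y)"
  by (simp add: sym_act_var_x refl2_eq_k scale2_eq const2_add const2_mult const2_1
      const2_numeral algebra_simps)

lemma refl2_var_y: "sym_act refl2 var_y = var_y + const2 k * (var_x + var_y)"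
  by (simp add: sym_act_var_y refl2_eq_k scale2_eq const2_add const2_1 algebra_simps)

lemma braid_refl: "refl1 ** refl2 ** refl1 = refl2 ** refl1 ** refl2"
  by (simp add: refl1_def refl2_eq_k root_j_eq_k vec_eq_iff forall_2 matrix_matrix_mult_def
      sum_2 algebra_simps)
    (intro conjI; use k_minimal in algebra)

lemma demazure_121_cube:
  assumes "a \<noteq> 0" and "b \<noteq> 0"
  defines "\<delta>1 \<equiv> demazure refl1 (scale2 a var_y)"
    and "\<delta>2 \<equiv> demazure refl2 (scale2 b (var_x + var_y))"
  shows "\<delta>1 (\<delta>2 (\<delta>1 (scale2 3 (var_x ^ 3)))) = 0"
proof -
  have "scale2 a var_y \<noteq> 0" "scale2 b (var_x + var_y) \<noteq> 0"
    using assms by (simp_all add: scale2_def var_x_def var_y_def)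
  then have "\<delta>1 0 = 0" "\<delta>2 0 = 0" "\<delta>1 (scale2 3 (var_x ^ 3)) = 0"
    by (auto simp: \<delta>1_def \<delta>2_def scale2_eq sym_act_hom refl1_var_x sym_act_0
        intro!: demazure_unique)
  then show ?thesis
    by simp
qed

text \<open>
  The intermediate quotients come from the eigenvectors \<open>\<alpha> = x + y\<close> and \<open>u = x - 2y\<close> of
  \<open>s\<^sub>2\<close>: it fixes \<open>u\<close> and multiplies \<open>\<alpha>\<close> by \<open>j\<close>, so the quotient of
  \<open>s\<^sub>2(\<alpha>\<^sup>m u\<^sup>n) - \<alpha>\<^sup>m u\<^sup>n\<close> by \<open>\<alpha>\<close> is
  \<open>(j\<^sup>m - 1) \<alpha>\<^sup>m\<^sup>-\<^sup>1 u\<^sup>n\<close> for \<open>m \<ge> 1\<close>, and zero for \<open>m = 0\<close>. Since \<open>3x = u + 2\<alpha>\<close> and \<open>j\<^sup>3 = 1\<close>, the quotient obtained from \<open>x\<^sup>3\<close>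
  has no \<open>\<alpha>\<^sup>2\<close> term and is divisible by \<open>u\<close>. The factor 3 in front of \<open>x\<^sup>3\<close> keeps the
  coefficients in \<open>\<int>[k]\<close>.
\<close>

lemma demazure_212_cube:
  assumes "a \<noteq> 0" and "b \<noteq> 0"
  defines "\<delta>1 \<equiv> demazure refl1 (scale2 a var_y)"
    and "\<delta>2 \<equiv> demazure refl2 (scale2 b (var_x + var_y))"
  shows "\<delta>2 (\<delta>1 (\<delta>2 (scale2 3 (var_x ^ 3)))) = const2 (24 * k\<^sup>2 / (a * b\<^sup>2))"
proof -
  define K where "K = const2 k"
  define p1 where "p1 = (var_x - 2 * var_y) * (5 * var_x + 2 * var_y + 6 * K * (var_x + var_y))"
  define p2 where "p2 = 4 * var_y - (8 + 6 * K) * var_x"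
  have K: "3 * K\<^sup>2 + 3 * K + 1 = 0"
    using const2_k_minimal by (simp add: K_def)
  have roots: "var_y \<noteq> 0" "var_x + var_y \<noteq> 0"
    by (simp_all add: var_x_def var_y_def)
  have s1: "sym_act refl1 var_x = var_x" "sym_act refl1 var_y = var_y + 3 * K * var_y"
    and s2: "sym_act refl2 var_x = var_x + 2 * K * (var_x + var_y)"
      "sym_act refl2 var_y = var_y + K * (var_x + var_y)"
    and sK: "\<And>A. sym_act A K = K"
    by (simp_all add: K_def refl1_var_x refl1_var_y refl2_var_x refl2_var_y sym_act_const2)
  have "sym_act refl2 (3 * var_x ^ 3) - 3 * var_x ^ 3 = (var_x + var_y) * (2 * K * p1)"
    unfolding sym_act_hom s2 p1_def using K by algebra
  then have "sym_act refl2 (scale2 3 (var_x ^ 3)) - scale2 3 (var_x ^ 3)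
      = (var_x + var_y) * scale2 (2 * k) p1"
    by (simp add: scale2_eq const2_mult const2_numeral K_def)
  from demazure_scale2[OF roots(2) assms(2) this, of 1]
  have 1: "\<delta>2 (scale2 3 (var_x ^ 3)) = scale2 (2 * k / b) p1"
    by (simp add: \<delta>2_def scale2_eq const2_1)
  have "sym_act refl1 p1 - p1 = var_y * (3 * K * p2)"
    unfolding sym_act_hom sK s1 p1_def p2_def using K by algebra
  then have "sym_act refl1 p1 - p1 = var_y * scale2 (3 * k) p2"
    by (simp add: scale2_eq const2_mult const2_numeral K_def)
  from demazure_scale2[OF roots(1) assms(1) this]
  have 2: "\<delta>1 (scale2 (2 * k / b) p1) = scale2 (6 * k\<^sup>2 / (a * b)) p2"
    by (simp add: \<delta>1_def power2_eq_square field_simps)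
  have "sym_act refl2 p2 - p2 = (var_x + var_y) * 4"
    unfolding sym_act_hom sK s2 p2_def using K by algebra
  then have "sym_act refl2 p2 - p2 = (var_x + var_y) * scale2 4 1"
    by (simp add: scale2_eq const2_numeral)
  from demazure_scale2[OF roots(2) assms(2) this]
  have 3: "\<delta>2 (scale2 (6 * k\<^sup>2 / (a * b)) p2) = const2 (24 * k\<^sup>2 / (a * b\<^sup>2))"
    by (simp add: \<delta>2_def scale2_eq power2_eq_square field_simps)
  show ?thesis
    by (simp only: 1 2 3)
qed

theorem proposition3p1:
  fixes a b :: complex and \<delta>1 \<delta>2 :: "cpoly2 \<Rightarrow> cpoly2"
  assumes "a \<noteq> 0" and "b \<noteq> 0"
    and "\<delta>1 = demazure refl1 (scale2 a var_y)"
    and "\<delta>2 = demazure refl2 (scale2 b (var_x + var_y))"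
  shows "\<delta>1 \<circ> \<delta>2 \<circ> \<delta>1 \<notin> {scale2 c \<circ> (\<delta>2 \<circ> \<delta>1 \<circ> \<delta>2) | c. c \<in> rat_adjoin_j - {0}}
    \<and> refl1 ** refl2 ** refl1 = refl2 ** refl1 ** refl2
    \<and> (\<nexists>c. c \<noteq> 0 \<and> \<delta>1 \<circ> \<delta>2 \<circ> \<delta>1 = scale2 c \<circ> (\<delta>2 \<circ> \<delta>1 \<circ> \<delta>2))"
proof -
  have no_scalar: "\<delta>1 \<circ> \<delta>2 \<circ> \<delta>1 \<noteq> scale2 c \<circ> (\<delta>2 \<circ> \<delta>1 \<circ> \<delta>2)" if "c \<noteq> 0" for c
  proof
    assume "\<delta>1 \<circ> \<delta>2 \<circ> \<delta>1 = scale2 c \<circ> (\<delta>2 \<circ> \<delta>1 \<circ> \<delta>2)"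
    from fun_cong[OF this, of "scale2 3 (var_x ^ 3)"]
    have "0 = scale2 c (const2 (24 * k\<^sup>2 / (a * b\<^sup>2)))"
      using demazure_121_cube[OF assms(1,2)] demazure_212_cube[OF assms(1,2)]
      by (simp add: assms(3,4))
    with that assms(1,2) k_nonzero show False
      by (simp add: scale2_def const2_def)
  qed
  then show ?thesis
    using braid_refl by blast
qed

end
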